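(* Let $\Gamma$ be a context, $P,P'\in\mathrm{Proc}(\Gamma)$, $a$ an action in $\Gamma$ and $R\in\mathrm{Proc}(\Gamma+|a|)$. Suppose $P\xrightarrow{a}R$ and $P\rtimes P'$ (generalised bound braid). Then there exists a process $R'\in\mathrm{Proc}(\Gamma+|a|)$ such that $P'\xrightarrow{a}R'$ and $R\rtimes R'$.
   Context: Synchronous $\pi$-calculus with de Bruijn indices. Contexts $\Gamma$ are natural numbers; a name in $\Gamma$ is a natural number $x<\Gamma$. The set $\mathrm{Proc}(\Gamma)$ of processes closed by $\Gamma$ is defined inductively: $\mathbf{0}\in\mathrm{Proc}(\Gamma)$; if $x<\Gamma$ and $P\in\mathrm{Proc}(\Gamma+1)$ then $\mathsf{in}\,x.P\in\mathrm{Proc}(\Gamma)$ (input on $x$, binding index $0$ in $P$); if $x,y<\Gamma$ and $P\in\mathrm{Proc}(\Gamma)$ then $\overline{x}\langle y\rangle.P\in\mathrm{Proc}(\Gamma)$; if $P,Q\in\mathrm{Proc}(\Gamma)$ then $P+Q$ and $P\mid Q$ are in $\mathrm{Proc}(\Gamma)$; if $P\in\mathrm{Proc}(\Gamma+1)$ then $\nu P\in\mathrm{Proc}(\Gamma)$; if $P\in\mathrm{Proc}(\Gamma)$ then $!P\in\mathrm{Proc}(\Gamma)$. Actions in $\Gamma$ are: bound actions $\mathsf{in}\,x$ (input) and $\overline{x}\langle\cdot\rangle$ (bound output) for $x<\Gamma$, and non-bound actions $\overline{x}\langle y\rangle$ (output) for $x,y<\Gamma$ and $\tau$. Set $|a|=1$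 if $a$ is bound and $|a|=0$ otherwise. A renaming $\rho:\Gamma\to\Delta$ is any function $\{0,\dots,\Gamma-1\}\to\{0,\dots,\Delta-1\}$. Its lifting $\rho+1:\Gamma+1\to\Delta+1$ maps $0\mapsto0$ and $x+1\mapsto\rho(x)+1$. Renamings act on actions by renaming every name ($\rho\tau=\tau$), and on processes by: $\rho\mathbf{0}=\mathbf{0}$, $\rho(\mathsf{in}\,x.P)=\mathsf{in}\,\rho(x).((\rho+1)P)$, $\rho(\overline{x}\langle y\rangle.P)=\overline{\rho x}\langle\rho y\rangle.\rho P$, $\rho(P+Q)=\rho P+\rho Q$, $\rho(P\mid Q)=\rho P\mid\rho Q$, $\rho(\nu P)=\nu((\rho+1)P)$, $\rho(!P)=!\rho P$. Special renamings: $\mathsf{push}:\Gamma\to\Gamma+1$, $x\mapsto x+1$; for $y<\Gamma$, $\mathsf{pop}\,y:\Gamma+1\to\Gamma$, $0\mapsto y$, $x+1\mapsto x$; $\mathsf{swap}:\Gamma+2\to\Gamma+2$ exchanging $0$ and $1$ and fixing all $x\ge2$. Transitions: for $P\in\mathrm{Proc}(\Gamma)$, an action $a$ in $\Gamma$ and $R\in\mathrm{Proc}(\Gamma+|a|)$, the relation $P\xrightarrow{a}R$ is the least relation closed under the following rules ($b$ ranges over bound actions, $c$ over non-bound actions): $\mathsf{in}\,x.P\xrightarrow{\mathsf{in}\,x}P$; $\overline{x}\langle y\rangle.P\xrightarrow{\overline{x}\langle y\rangle}P$; if $P\xrightarrow{a}R$ then $P+Q\xrightarrow{a}R$; if $Q\xrightarrow{a}S$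 then $P+Q\xrightarrow{a}S$; if $P\xrightarrow{c}R$ then $P\mid Q\xrightarrow{c}R\mid Q$; if $Q\xrightarrow{c}S$ then $P\mid Q\xrightarrow{c}P\mid S$; if $P\xrightarrow{b}R$ then $P\mid Q\xrightarrow{b}R\mid\mathsf{push}\,Q$; if $Q\xrightarrow{b}S$ then $P\mid Q\xrightarrow{b}\mathsf{push}\,P\mid S$; if $P\xrightarrow{\mathsf{in}\,x}R$ and $Q\xrightarrow{\overline{x}\langle y\rangle}S$ then $P\mid Q\xrightarrow{\tau}(\mathsf{pop}\,y)R\mid S$; symmetrically if $P\xrightarrow{\overline{x}\langle y\rangle}R$ and $Q\xrightarrow{\mathsf{in}\,x}S$ then $P\mid Q\xrightarrow{\tau}R\mid(\mathsf{pop}\,y)S$; if $P\xrightarrow{\overline{x+1}\langle 0\rangle}R$ then $\nu P\xrightarrow{\overline{x}\langle\cdot\rangle}R$; if $P\xrightarrow{\mathsf{in}\,x}R$ and $Q\xrightarrow{\overline{x}\langle\cdot\rangle}S$ then $P\mid Q\xrightarrow{\tau}\nu(R\mid S)$; symmetrically if $P\xrightarrow{\overline{x}\langle\cdot\rangle}R$ and $Q\xrightarrow{\mathsf{in}\,x}S$ then $P\mid Q\xrightarrow{\tau}\nu(R\mid S)$; if $P\xrightarrow{\mathsf{push}\,c}R$ then $\nu P\xrightarrow{c}\nu R$; if $P\xrightarrow{\mathsf{push}\,b}R$ then $\nu P\xrightarrow{b}\nu(\mathsf{swap}\,R)$; if $P\mid !P\xrightarrow{a}R$ then $!P\xrightarrow{a}R$.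 Generalised bound braid: for $P,R\in\mathrm{Proc}(\Gamma)$, the relation $P\rtimes R$ is defined inductively by: if $P,R\in\mathrm{Proc}(\Gamma+2)$ and $P=\mathsf{swap}\,R$ then $\nu\nu P\rtimes\nu\nu R$; $\mathbf{0}\rtimes\mathbf{0}$; $\mathsf{in}\,x.P\rtimes\mathsf{in}\,x.P$; $\overline{x}\langle y\rangle.P\rtimes\overline{x}\langle y\rangle.P$; if $P\rtimes R$ then $P+Q\rtimes R+Q$; if $Q\rtimes S$ then $P+Q\rtimes P+S$; if $P\rtimes R$ and $Q\rtimes S$ then $P\mid Q\rtimes R\mid S$; if $P\rtimes R$ then $\nu P\rtimes\nu R$; if $P\rtimes R$ then $!P\rtimes !R$. *)

theory Defs imports Main begin

text \<open>
  Names are de Bruijn indices. Raw processes and actions carry arbitrary natural numbers; the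
  predicates \<open>Proc \<Gamma>\<close> and \<open>Action \<Gamma>\<close> single out those in context \<open>\<Gamma>\<close>.
\<close>

datatype proc =
    Zero
  | Inp nat proc
  | Out nat nat proc
  | Sum proc proc
  | Par proc proc
  | Nu proc
  | Bang proc

inductive Proc :: "nat \<Rightarrow> proc \<Rightarrow> bool" where
  Zero: "Proc \<Gamma> Zero"
| Inp: "x < \<Gamma> \<Longrightarrow> Proc (\<Gamma> + 1) P \<Longrightarrow> Proc \<Gamma> (Inp x P)"
| Out: "x < \<Gamma> \<Longrightarrow> y < \<Gamma> \<Longrightarrow> Proc \<Gamma> P \<Longrightarrow> Proc \<Gamma> (Out x y P)"
| Sum: "Proc \<Gamma> P \<Longrightarrow> Proc \<Gamma> Q \<Longrightarrow> Proc \<Gamma> (Sum P Q)"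
| Par: "Proc \<Gamma> P \<Longrightarrow> Proc \<Gamma> Q \<Longrightarrow> Proc \<Gamma> (Par P Q)"
| Nu: "Proc (\<Gamma> + 1) P \<Longrightarrow> Proc \<Gamma> (Nu P)"
| Bang: "Proc \<Gamma> P \<Longrightarrow> Proc \<Gamma> (Bang P)"

datatype action =
    AInp nat
  | ABOut nat
  | AOut nat nat
  | ATau

primrec Action :: "nat \<Rightarrow> action \<Rightarrow> bool" where
  "Action \<Gamma> (AInp x) \<longleftrightarrow> x < \<Gamma>"
| "Action \<Gamma> (ABOut x) \<longleftrightarrow> x < \<Gamma>"
| "Action \<Gamma> (AOut x y) \<longleftrightarrow> x < \<Gamma> \<and> y < \<Gamma>"
| "Action \<Gamma> ATau \<longleftrightarrow> True"

primrec bound :: "action \<Rightarrow> bool" where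
  "bound (AInp x) = True"
| "bound (ABOut x) = True"
| "bound (AOut x y) = False"
| "bound ATau = False"

definition bsize :: "action \<Rightarrow> nat" where
  "bsize a = (if bound a then 1 else 0)"

text \<open>
  A renaming from \<open>\<Gamma>\<close> to \<open>\<Delta>\<close> is represented by a total function on \<^typ>\<open>nat\<close> sending indices below
  \<open>\<Gamma>\<close> to indices below \<open>\<Delta>\<close>; its values outside \<open>\<Gamma>\<close> do not affect the image of a process in \<open>\<Gamma>\<close>.
\<close>

primrec lift :: "(nat \<Rightarrow> nat) \<Rightarrow> nat \<Rightarrow> nat" where
  "lift \<rho> 0 = 0"
| "lift \<rho> (Suc x) = \<rho> x + 1"

primrec ren :: "(nat \<Rightarrow> nat) \<Rightarrow> proc \<Rightarrow> proc" where
  "ren \<rho> Zero = Zero"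
| "ren \<rho> (Inp x P) = Inp (\<rho> x) (ren (lift \<rho>) P)"
| "ren \<rho> (Out x y P) = Out (\<rho> x) (\<rho> y) (ren \<rho> P)"
| "ren \<rho> (Sum P Q) = Sum (ren \<rho> P) (ren \<rho> Q)"
| "ren \<rho> (Par P Q) = Par (ren \<rho> P) (ren \<rho> Q)"
| "ren \<rho> (Nu P) = Nu (ren (lift \<rho>) P)"
| "ren \<rho> (Bang P) = Bang (ren \<rho> P)"

primrec aren :: "(nat \<Rightarrow> nat) \<Rightarrow> action \<Rightarrow> action" where
  "aren \<rho> (AInp x) = AInp (\<rho> x)"
| "aren \<rho> (ABOut x) = ABOut (\<rho> x)"
| "aren \<rho> (AOut x y) = AOut (\<rho> x) (\<rho> y)"
| "aren \<rho> ATau = ATau"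

definition push :: "nat \<Rightarrow> nat" where
  "push x = x + 1"

primrec pop :: "nat \<Rightarrow> nat \<Rightarrow> nat" where
  "pop y 0 = y"
| "pop y (Suc x) = x"

definition swap :: "nat \<Rightarrow> nat" where
  "swap x = (if x = 0 then 1 else if x = 1 then 0 else x)"

text \<open>
  \<open>transition \<Gamma> P a R\<close> is the transition relation in context \<open>\<Gamma>\<close>. Explicit scoping premises occur only
  where they do not follow from the transition premises; lemma \<open>transition_scoped\<close> below shows that
  \<open>transition \<Gamma>\<close> relates only well-scoped processes and actions.
\<close>

inductive transition :: "nat \<Rightarrow> proc \<Rightarrow> action \<Rightarrow> proc \<Rightarrow> bool" where
  inp: "x < \<Gamma> \<Longrightarrow> Proc (\<Gamma> + 1) P \<Longrightarrow> transition \<Gamma> (Inp x P) (AInp x) P"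
| out: "x < \<Gamma> \<Longrightarrow> y < \<Gamma> \<Longrightarrow> Proc \<Gamma> P \<Longrightarrow> transition \<Gamma> (Out x y P) (AOut x y) P"
| sum_left: "transition \<Gamma> P a R \<Longrightarrow> Proc \<Gamma> Q \<Longrightarrow> transition \<Gamma> (Sum P Q) a R"
| sum_right: "transition \<Gamma> Q a S \<Longrightarrow> Proc \<Gamma> P \<Longrightarrow> transition \<Gamma> (Sum P Q) a S"
| par_left: "transition \<Gamma> P c R \<Longrightarrow> \<not> bound c \<Longrightarrow> Proc \<Gamma> Q \<Longrightarrow> transition \<Gamma> (Par P Q) c (Par R Q)"
| par_right: "transition \<Gamma> Q c S \<Longrightarrow> \<not> bound c \<Longrightarrow> Proc \<Gamma> P \<Longrightarrow> transition \<Gamma> (Par P Q) c (Par P S)"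
| par_left_bound:
    "transition \<Gamma> P b R \<Longrightarrow> bound b \<Longrightarrow> Proc \<Gamma> Q \<Longrightarrow> transition \<Gamma> (Par P Q) b (Par R (ren push Q))"
| par_right_bound:
    "transition \<Gamma> Q b S \<Longrightarrow> bound b \<Longrightarrow> Proc \<Gamma> P \<Longrightarrow> transition \<Gamma> (Par P Q) b (Par (ren push P) S)"
| comm_left:
    "transition \<Gamma> P (AInp x) R \<Longrightarrow> transition \<Gamma> Q (AOut x y) S \<Longrightarrow>
     transition \<Gamma> (Par P Q) ATau (Par (ren (pop y) R) S)"
| comm_right:
    "transition \<Gamma> P (AOut x y) R \<Longrightarrow> transition \<Gamma> Q (AInp x) S \<Longrightarrow>
     transition \<Gamma> (Par P Q) ATau (Par R (ren (pop y) S))"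
| extrude: "transition (\<Gamma> + 1) P (AOut (x + 1) 0) R \<Longrightarrow> transition \<Gamma> (Nu P) (ABOut x) R"
| close_left:
    "transition \<Gamma> P (AInp x) R \<Longrightarrow> transition \<Gamma> Q (ABOut x) S \<Longrightarrow> transition \<Gamma> (Par P Q) ATau (Nu (Par R S))"
| close_right:
    "transition \<Gamma> P (ABOut x) R \<Longrightarrow> transition \<Gamma> Q (AInp x) S \<Longrightarrow> transition \<Gamma> (Par P Q) ATau (Nu (Par R S))"
| nu: "transition (\<Gamma> + 1) P (aren push c) R \<Longrightarrow> \<not> bound c \<Longrightarrow> transition \<Gamma> (Nu P) c (Nu R)"
| nu_bound:
    "transition (\<Gamma> + 1) P (aren push b) R \<Longrightarrow> bound b \<Longrightarrow> transition \<Gamma> (Nu P) b (Nu (ren swap R))"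
| bang: "transition \<Gamma> (Par P (Bang P)) a R \<Longrightarrow> transition \<Gamma> (Bang P) a R"

text \<open>The generalised bound braid relation in context \<open>\<Gamma>\<close>.\<close>

inductive braid :: "nat \<Rightarrow> proc \<Rightarrow> proc \<Rightarrow> bool" where
  swap: "Proc (\<Gamma> + 2) P \<Longrightarrow> Proc (\<Gamma> + 2) R \<Longrightarrow> P = ren swap R \<Longrightarrow> braid \<Gamma> (Nu (Nu P)) (Nu (Nu R))"
| zero: "braid \<Gamma> Zero Zero"
| inp: "x < \<Gamma> \<Longrightarrow> Proc (\<Gamma> + 1) P \<Longrightarrow> braid \<Gamma> (Inp x P) (Inp x P)"
| out: "x < \<Gamma> \<Longrightarrow> y < \<Gamma> \<Longrightarrow> Proc \<Gamma> P \<Longrightarrow> braid \<Gamma> (Out x y P) (Out x y P)"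
| sum_left: "braid \<Gamma> P R \<Longrightarrow> Proc \<Gamma> Q \<Longrightarrow> braid \<Gamma> (Sum P Q) (Sum R Q)"
| sum_right: "braid \<Gamma> Q S \<Longrightarrow> Proc \<Gamma> P \<Longrightarrow> braid \<Gamma> (Sum P Q) (Sum P S)"
| par: "braid \<Gamma> P R \<Longrightarrow> braid \<Gamma> Q S \<Longrightarrow> braid \<Gamma> (Par P Q) (Par R S)"
| nu: "braid (\<Gamma> + 1) P R \<Longrightarrow> braid \<Gamma> (Nu P) (Nu R)"
| bang: "braid \<Gamma> P R \<Longrightarrow> braid \<Gamma> (Bang P) (Bang R)"

inductive_simps Proc_simps:
  "Proc \<Gamma> Zero" "Proc \<Gamma> (Inp x P)" "Proc \<Gamma> (Out x y P)" "Proc \<Gamma> (Sum P Q)"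
  "Proc \<Gamma> (Par P Q)" "Proc \<Gamma> (Nu P)" "Proc \<Gamma> (Bang P)"

lemma lift_scoped:
  assumes "\<And>x. x < \<Gamma> \<Longrightarrow> \<rho> x < \<Delta>" and "x < \<Gamma> + 1"
  shows "lift \<rho> x < \<Delta> + 1"
  using assms by (cases x) auto

lemma ren_scoped:
  assumes "Proc \<Gamma> P" and "\<And>x. x < \<Gamma> \<Longrightarrow> \<rho> x < \<Delta>"
  shows "Proc \<Delta> (ren \<rho> P)"
  using assms
proof (induction arbitrary: \<rho> \<Delta> rule: Proc.induct)
  case (Inp x \<Gamma> P)
  have "Proc (\<Delta> + 1) (ren (lift \<rho>) P)"
    by (rule Inp.IH) (rule lift_scoped[OF Inp.prems])
  with Inp show ?case by (simp add: Proc_simps)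
next
  case (Nu \<Gamma> P)
  have "Proc (\<Delta> + 1) (ren (lift \<rho>) P)"
    by (rule Nu.IH) (rule lift_scoped[OF Nu.prems])
  then show ?case by (simp add: Proc_simps)
qed (simp_all add: Proc_simps)

lemma push_scoped: "x < \<Gamma> \<Longrightarrow> push x < Suc \<Gamma>"
  by (simp add: push_def)

lemma pop_scoped: "y < \<Gamma> \<Longrightarrow> x < Suc \<Gamma> \<Longrightarrow> pop y x < \<Gamma>"
  by (cases x) auto

lemma swap_scoped: "x < Suc (Suc \<Gamma>) \<Longrightarrow> swap x < Suc (Suc \<Gamma>)"
  by (simp add: swap_def)

lemma bound_aren [simp]: "bound (aren \<rho> a) = bound a"
  by (cases a) auto

lemma Action_push: "Action (Suc \<Gamma>) (aren push a) = Action \<Gamma> a"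
  by (cases a) (auto simp: push_def)

lemma transition_scoped:
  assumes "transition \<Gamma> P a R"
  shows "Proc \<Gamma> P \<and> Action \<Gamma> a \<and> Proc (\<Gamma> + bsize a) R"
  using assms
  by induction
    (auto simp: Proc_simps bsize_def Action_push
      intro: ren_scoped[OF _ push_scoped] ren_scoped[OF _ pop_scoped] ren_scoped[OF _ swap_scoped])

lemma braid_scoped:
  assumes "braid \<Gamma> P R"
  shows "Proc \<Gamma> P \<and> Proc \<Gamma> R"
  using assms by induction (auto simp: Proc_simps)

end

theory Submission imports Defs begin

text \<open>
  Transitions and braids are both preserved by renaming. The theorem is proved by induction on the
  transition. The only case that is not a congruence is \<open>\<nu>\<nu>(swap P) \<rtimes> \<nu>\<nu>P\<close>: after a bound
  action crossing both binders, the targets braid thanks to the Coxeter relation between \<open>swap\<close> and \<open>swap + 1\<close>,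
  whereas if one of the binders is extruded, exchanging them exchanges the two derivations (extrude
  outside, propagate inside, and vice versa), with equal targets.
\<close>

section \<open>Algebra of renamings: functoriality and the laws of \<open>push\<close>,
  \<open>pop\<close> and \<open>swap\<close>\<close>

lemma lift_comp: "lift \<rho> \<circ> lift \<sigma> = lift (\<rho> \<circ> \<sigma>)"
proof
  show "(lift \<rho> \<circ> lift \<sigma>) x = lift (\<rho> \<circ> \<sigma>) x" for x
    by (cases x) simp_all
qed

lemma lift_id [simp]: "lift (\<lambda>x. x) = (\<lambda>x. x)"
proof
  show "lift (\<lambda>x. x) x = x" for x
    by (cases x) simp_all
qed

lemma ren_ren: "ren \<rho> (ren \<sigma> P) = ren (\<rho> \<circ> \<sigma>) P"
  by (induction P arbitrary: \<rho> \<sigma>) (simp_all add: lift_comp)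

lemma ren_id [simp]: "ren (\<lambda>x. x) P = P"
  by (induction P) simp_all

lemma aren_aren: "aren \<rho> (aren \<sigma> a) = aren (\<rho> \<circ> \<sigma>) a"
  by (cases a) simp_all

lemma lift_push: "lift \<rho> \<circ> push = push \<circ> \<rho>"
  by (simp add: fun_eq_iff push_def)

lemma lift_pop: "\<rho> \<circ> pop y = pop (\<rho> y) \<circ> lift \<rho>"
proof
  show "(\<rho> \<circ> pop y) x = (pop (\<rho> y) \<circ> lift \<rho>) x" for x
    by (cases x) simp_all
qed

text \<open>Naturality of \<open>swap\<close>: a doubly lifted renaming fixes 0 and 1 and sends
  larger indices to indices at least 2, which \<open>swap\<close> leaves alone.\<close>

lemma lift_swap: "lift (lift \<rho>) \<circ> swap = swap \<circ> lift (lift \<rho>)"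
proof
  fix x
  consider "x = 0" | "x = 1" | y where "x = Suc (Suc y)"
    by (metis One_nat_def not0_implies_Suc)
  then show "(lift (lift \<rho>) \<circ> swap) x = (swap \<circ> lift (lift \<rho>)) x"
    by cases (simp_all add: swap_def)
qed

lemma swap_swap: "swap \<circ> swap = (\<lambda>x. x)"
  by (simp add: fun_eq_iff swap_def)

text \<open>An action that passes through two binders mentions neither of them, so exchanging the
  binders does not affect it.\<close>

lemma swap_push_push: "swap \<circ> (push \<circ> push) = push \<circ> push"
  by (simp add: fun_eq_iff swap_def push_def)

text \<open>With s0 = \<open>swap\<close> and s1 = \<open>lift swap\<close>, this is the Coxeter
  relation s0 s1 s0 = s1 s0 s1 multiplied on the right by the involution s1. The form, with an
  outermost \<open>swap\<close> on one side, fits the premise \<open>P = ren swap R\<close> of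
  \<open>braid.swap\<close>.\<close>

lemma swap_Coxeter: "lift swap \<circ> swap = swap \<circ> (lift swap \<circ> (swap \<circ> lift swap))"
proof
  fix x :: nat
  consider "x = 0" | "x = 1" | "x = 2" | y where "x = Suc (Suc (Suc y))"
    by (metis One_nat_def Suc_1 not0_implies_Suc)
  then show "(lift swap \<circ> swap) x = (swap \<circ> (lift swap \<circ> (swap \<circ> lift swap))) x"
    by cases (simp_all add: swap_def numeral_2_eq_2)
qed

lemma ren_lift_push: "ren (lift \<rho>) (ren push P) = ren push (ren \<rho> P)"
  by (simp add: ren_ren lift_push)

lemma aren_lift_push: "aren (lift \<rho>) (aren push a) = aren push (aren \<rho> a)"
  by (simp add: aren_aren lift_push)

lemma ren_pop: "ren \<rho> (ren (pop y) P) = ren (pop (\<rho> y)) (ren (lift \<rho>) P)"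
  by (simp add: ren_ren lift_pop)

lemma ren_lift_swap: "ren (lift (lift \<rho>)) (ren swap P) = ren swap (ren (lift (lift \<rho>)) P)"
  by (simp add: ren_ren lift_swap)

lemma ren_swap_swap [simp]: "ren swap (ren swap P) = P"
  by (simp add: ren_ren swap_swap)

lemma aren_swap_push_push: "aren swap (aren push (aren push a)) = aren push (aren push a)"
  by (simp add: aren_aren swap_push_push)

lemma ren_swap_Coxeter:
  "ren (lift swap) (ren swap P) = ren swap (ren (lift swap) (ren swap (ren (lift swap) P)))"
  using swap_Coxeter by (simp add: ren_ren)

section \<open>Stability of transitions and braids under renaming\<close>

lemma transition_ren:
  assumes "transition \<Gamma> P a R" and "\<And>x. x < \<Gamma> \<Longrightarrow> \<rho> x < \<Delta>"
  shows "transition \<Delta> (ren \<rho> P) (aren \<rho> a) (ren (if bound a then lift \<rho> else \<rho>) R)"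
  using assms
proof (induction arbitrary: \<rho> \<Delta> rule: transition.induct)
  case (inp x \<Gamma> P)
  have "Proc (\<Delta> + 1) (ren (lift \<rho>) P)"
    using inp.hyps(2) lift_scoped[OF inp.prems] by (rule ren_scoped)
  with inp show ?case by (simp add: transition.inp)
next
  case (out x \<Gamma> y P)
  then show ?case by (simp add: transition.out ren_scoped)
next
  case (sum_left \<Gamma> P a R Q)
  then show ?case by (simp add: transition.sum_left ren_scoped)
next
  case (sum_right \<Gamma> Q a S P)
  then show ?case by (simp add: transition.sum_right ren_scoped)
next
  case (par_left \<Gamma> P c R Q)
  then show ?case using transition.par_left[of \<Delta> "ren \<rho> P" "aren \<rho> c"] by (simp add: ren_scoped)
next
  case (par_right \<Gamma> Q c S P)
  then show ?case using transition.par_right[of \<Delta> "ren \<rho> Q" "aren \<rho> c"] by (simp add: ren_scoped)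
next
  case (par_left_bound \<Gamma> P b R Q)
  then show ?case using transition.par_left_bound[of \<Delta> "ren \<rho> P" "aren \<rho> b"]
    by (simp add: ren_scoped ren_lift_push)
next
  case (par_right_bound \<Gamma> Q b S P)
  then show ?case using transition.par_right_bound[of \<Delta> "ren \<rho> Q" "aren \<rho> b"]
    by (simp add: ren_scoped ren_lift_push)
next
  case (comm_left \<Gamma> P x R Q y S)
  have "transition \<Delta> (ren \<rho> P) (AInp (\<rho> x)) (ren (lift \<rho>) R)"
    "transition \<Delta> (ren \<rho> Q) (AOut (\<rho> x) (\<rho> y)) (ren \<rho> S)"
    using comm_left.IH[OF comm_left.prems] by simp_all
  then show ?case by (simp add: ren_pop transition.comm_left)
next
  case (comm_right \<Gamma> P x y R Q S)
  have "transition \<Delta> (ren \<rho> P) (AOut (\<rho> x) (\<rho> y)) (ren \<rho> R)"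
    "transition \<Delta> (ren \<rho> Q) (AInp (\<rho> x)) (ren (lift \<rho>) S)"
    using comm_right.IH[OF comm_right.prems] by simp_all
  then show ?case by (simp add: ren_pop transition.comm_right)
next
  case (extrude \<Gamma> P x R)
  \<comment> \<open>\<open>lift \<rho>\<close> fixes 0 and keeps successors successors, so the
    renamed output still has the shape required by \<open>extrude\<close>.\<close>
  have "transition (\<Delta> + 1) (ren (lift \<rho>) P) (AOut (\<rho> x + 1) 0) (ren (lift \<rho>) R)"
    using extrude.IH[of "lift \<rho>" "\<Delta> + 1"] lift_scoped[OF extrude.prems] by simp
  then show ?case using transition.extrude by simp
next
  case (close_left \<Gamma> P x R Q S)
  have "transition \<Delta> (ren \<rho> P) (AInp (\<rho> x)) (ren (lift \<rho>) R)"
    "transition \<Delta> (ren \<rho> Q) (ABOut (\<rho> x)) (ren (lift \<rho>) S)"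
    using close_left.IH[OF close_left.prems] by simp_all
  then show ?case by (simp add: transition.close_left)
next
  case (close_right \<Gamma> P x R Q S)
  have "transition \<Delta> (ren \<rho> P) (ABOut (\<rho> x)) (ren (lift \<rho>) R)"
    "transition \<Delta> (ren \<rho> Q) (AInp (\<rho> x)) (ren (lift \<rho>) S)"
    using close_right.IH[OF close_right.prems] by simp_all
  then show ?case by (simp add: transition.close_right)
next
  case (nu \<Gamma> P c R)
  have "transition (\<Delta> + 1) (ren (lift \<rho>) P) (aren push (aren \<rho> c)) (ren (lift \<rho>) R)"
    using nu.IH[of "lift \<rho>" "\<Delta> + 1"] lift_scoped[OF nu.prems] nu.hyps by (simp add: aren_lift_push)
  then show ?case using nu.hyps by (simp add: transition.nu)
next
  case (nu_bound \<Gamma> P b R)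
  have "transition (\<Delta> + 1) (ren (lift \<rho>) P) (aren push (aren \<rho> b)) (ren (lift (lift \<rho>)) R)"
    using nu_bound.IH[of "lift \<rho>" "\<Delta> + 1"] lift_scoped[OF nu_bound.prems] nu_bound.hyps by (simp add: aren_lift_push)
  then show ?case using nu_bound.hyps by (simp add: transition.nu_bound ren_lift_swap)
next
  case (bang \<Gamma> P a R)
  then show ?case by (simp add: transition.bang)
qed

lemma braid_refl: "Proc \<Gamma> P \<Longrightarrow> braid \<Gamma> P P"
  by (induction rule: Proc.induct) (auto intro: braid.intros)

lemma braid_ren:
  assumes "braid \<Gamma> P R" and "\<And>x. x < \<Gamma> \<Longrightarrow> \<rho> x < \<Delta>"
  shows "braid \<Delta> (ren \<rho> P) (ren \<rho> R)"
  using assms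
proof (induction arbitrary: \<rho> \<Delta> rule: braid.induct)
  case (swap \<Gamma> P R)
  have scoped: "lift (lift \<rho>) x < \<Delta> + 2" if "x < \<Gamma> + 2" for x
    using lift_scoped[of "\<Gamma> + 1" "lift \<rho>" "\<Delta> + 1" x] lift_scoped[OF swap.prems] that by simp
  show ?case
    using ren_scoped[OF swap.hyps(1), of "lift (lift \<rho>)" "\<Delta> + 2"]
      ren_scoped[OF swap.hyps(2), of "lift (lift \<rho>)" "\<Delta> + 2"] scoped swap.hyps(3)
    by (simp add: braid.swap ren_lift_swap)
next
  case (inp x \<Gamma> P)
  \<comment> \<open>Braids do not reach under a prefix: both sides are the same process, and
    reflexivity suffices.\<close>
  have "Proc \<Gamma> (Inp x P)" using inp.hyps by (simp add: Proc_simps)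
  then show ?case using inp.prems by (intro braid_refl ren_scoped)
next
  case (nu \<Gamma> P R)
  then show ?case using lift_scoped[OF nu.prems] by (simp add: braid.nu)
qed (simp_all add: braid.intros ren_scoped)

lemma braid_push: "braid \<Gamma> P R \<Longrightarrow> braid (Suc \<Gamma>) (ren push P) (ren push R)"
  by (erule braid_ren) (rule push_scoped)

lemma braid_pop: "braid (Suc \<Gamma>) P R \<Longrightarrow> y < \<Gamma> \<Longrightarrow> braid \<Gamma> (ren (pop y) P) (ren (pop y) R)"
  by (erule braid_ren) (rule pop_scoped)

lemma braid_ren_swap:
  "braid (Suc (Suc \<Gamma>)) P R \<Longrightarrow> braid (Suc (Suc \<Gamma>)) (ren swap P) (ren swap R)"
  by (erule braid_ren) (rule swap_scoped)

section \<open>Inversion rules and the transitions of a doubly restricted process\<close>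

inductive_cases transition_NuE [consumes 1, case_names extrude nu nu_bound]: "transition \<Gamma> (Nu P) a R"

inductive_cases braid_InpE: "braid \<Gamma> (Inp x P) P'"
inductive_cases braid_OutE: "braid \<Gamma> (Out x y P) P'"
inductive_cases braid_SumE [consumes 1, case_names left right]: "braid \<Gamma> (Sum P Q) P'"
inductive_cases braid_ParE: "braid \<Gamma> (Par P Q) P'"
inductive_cases braid_NuE [consumes 1, case_names swap nu]: "braid \<Gamma> (Nu P) P'"
inductive_cases braid_BangE: "braid \<Gamma> (Bang P) P'"

lemma transition_ren_swap:
  assumes "transition (Suc (Suc \<Gamma>)) P a R"
  shows "transition (Suc (Suc \<Gamma>)) (ren swap P) (aren swap a)
    (ren (if bound a then lift swap else swap) R)"
  using assms swap_scoped by (rule transition_ren)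

lemma transition_Nu_Nu_swap:
  assumes "transition \<Gamma> (Nu (Nu P)) a T"
  shows "\<exists>T'. transition \<Gamma> (Nu (Nu (ren swap P))) a T' \<and> braid (\<Gamma> + bsize a) T T'"
  using assms
proof (cases rule: transition_NuE)
  case (extrude x)
  \<comment> \<open>The outer binder is extruded by a non-bound output, which the inner binder can
    only propagate. Inside \<open>P\<close> the extruded name is index 1; after \<open>swap\<close>
    it is index 0, so the inner binder now extrudes. The \<open>swap\<close> added by
    \<open>nu_bound\<close> cancels the one on \<open>R\<close>, and the target is again
    \<open>T\<close>.\<close>
  from extrude(2) obtain R where
    R: "T = Nu R" "transition (\<Gamma> + 1 + 1) P (aren push (AOut (x + 1) 0)) R"
    by (cases rule: transition_NuE) auto
  have "transition (\<Gamma> + 1 + 1) (ren swap P) (AOut (x + 1 + 1) 0) (ren swap R)"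
    using transition_ren_swap[of \<Gamma> P "AOut (x + 1 + 1) 1" R] R(2) by (simp add: push_def swap_def)
  then have "transition (\<Gamma> + 1) (Nu (ren swap P)) (aren push (ABOut x)) (ren swap R)"
    using transition.extrude by (simp add: push_def)
  then have "transition \<Gamma> (Nu (Nu (ren swap P))) a T"
    using transition.nu_bound[of \<Gamma> _ "ABOut x" "ren swap R"] extrude R by simp
  then show ?thesis
    using transition_scoped braid_refl by blast
next
  case (nu R1)
  from nu(2,3) obtain R where
    R: "R1 = Nu R" "transition (\<Gamma> + 1 + 1) P (aren push (aren push a)) R"
    \<comment> \<open>Applying \<open>bound\<close> to the equation between actions rules out
      extrusion at the inner binder, whose label would be bound.\<close>
    by (cases rule: transition_NuE) (auto dest: arg_cong[where f = bound])
  have "transition (\<Gamma> + 1 + 1) (ren swap P) (aren push (aren push a)) (ren swap R)"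
    using transition_ren_swap R(2) nu(3) by (fastforce simp: aren_swap_push_push)
  then have tr: "transition \<Gamma> (Nu (Nu (ren swap P))) a (Nu (Nu (ren swap R)))"
    using nu(3) by (intro transition.nu) simp_all
  have "Proc (\<Gamma> + 2) R" "Proc (\<Gamma> + 2) (ren swap R)"
    using transition_scoped[OF R(2)] nu(3) ren_scoped[OF _ swap_scoped] by (auto simp: bsize_def)
  then have "braid \<Gamma> (Nu (Nu R)) (Nu (Nu (ren swap R)))"
    by (intro braid.swap) simp_all
  with tr show ?thesis using nu(1,3) R(1) by (auto simp: bsize_def)
next
  case outer: (nu_bound R1)
  from outer(2) show ?thesis
  proof (cases rule: transition_NuE)
    case (extrude z)
    \<comment> \<open>The mirror image of the first case: here the inner binder is extruded. Its
      label has been pushed past the outer binder, so \<open>z\<close> is a successor. After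
      \<open>swap\<close> the output carries index 1, passes through the inner binder and is
      extruded by the outer one.\<close>
    from extrude(1) obtain x where x: "a = ABOut x" "z = x + 1"
      by (cases a) (auto simp: push_def)
    have "transition (\<Gamma> + 1 + 1) (ren swap P) (aren push (AOut (x + 1) 0)) (ren swap R1)"
      using transition_ren_swap[of \<Gamma> P "AOut (x + 2) 0" R1] extrude(2) x by (simp add: push_def swap_def)
    then have "transition \<Gamma> (Nu (Nu (ren swap P))) (ABOut x) (Nu (ren swap R1))"
      by (intro transition.extrude transition.nu) simp_all
    then show ?thesis
      using outer(1) x transition_scoped braid_refl by blast
  next
    case (nu R)
    then show ?thesis using outer(3) by simp
  next
    case (nu_bound R)
    note b = \<open>bound a\<close>
    \<comment> \<open>\<open>R\<close> has the index bound by the action at 0, so the exchange of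
      the two binders acts on it as \<open>lift swap\<close>. Each \<open>nu_bound\<close> then adds
      one \<open>swap\<close>: below the two restrictions, \<open>T\<close> has s1 s0 applied to
      \<open>R\<close> and the new target has s1 s0 s1, which differ by one s0 on the left.\<close>
    have "transition (\<Gamma> + 1 + 1) (ren swap P) (aren push (aren push a)) (ren (lift swap) R)"
      using transition_ren_swap[of \<Gamma> P "aren push (aren push a)" R] nu_bound b
      by (simp add: aren_swap_push_push)
    then have tr: "transition \<Gamma> (Nu (Nu (ren swap P))) a
        (Nu (ren swap (Nu (ren swap (ren (lift swap) R)))))" (is "transition _ _ _ ?T'")
      using b by (intro transition.nu_bound) simp_all
    have "Proc (\<Gamma> + 1) T" "Proc (\<Gamma> + 1) ?T'"
      using transition_scoped[OF assms] transition_scoped[OF tr] b by (auto simp: bsize_def)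
    then have "braid (\<Gamma> + 1) T ?T'"
      using \<open>T = _\<close> \<open>R1 = _\<close> ren_swap_Coxeter[of R]
      by (auto simp: Proc_simps intro: braid.swap)
    with tr show ?thesis using b by (auto simp: bsize_def)
  qed
qed

section \<open>The simulation property\<close>

text \<open>Induction on the transition rather than on the braid is what handles replication, where
  the premise concerns the larger process \<open>Par P (Bang P)\<close>. \<open>P'\<close> is
  generalised because each premise is matched against its own braided process.\<close>

lemma braid_simulation:
  assumes "transition \<Gamma> P a R" and "braid \<Gamma> P P'"
  shows "\<exists>R'. transition \<Gamma> P' a R' \<and> braid (\<Gamma> + bsize a) R R'"
  using assms
proof (induction arbitrary: P' rule: transition.induct)
  case (inp x \<Gamma> P)
  then show ?case by (auto elim!: braid_InpE intro!: exI transition.inp braid_refl simp: bsize_def)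
next
  case (out x \<Gamma> y P)
  then show ?case by (auto elim!: braid_OutE intro!: exI transition.out braid_refl simp: bsize_def)
next
  case (sum_left \<Gamma> P a R Q)
  from sum_left.prems show ?case
  proof (cases rule: braid_SumE)
    case (left P1)
    with sum_left show ?thesis by (blast intro: transition.sum_left)
  next
    \<comment> \<open>The braid acts on the discarded summand only, so the same transition is
      available with the same target.\<close>
    case (right Q1)
    with sum_left braid_scoped transition_scoped show ?thesis
      by (blast intro: transition.sum_left braid_refl)
  qed
next
  case (sum_right \<Gamma> Q a S P)
  from sum_right.prems show ?case
  proof (cases rule: braid_SumE)
    case (left P1)
    with sum_right braid_scoped transition_scoped show ?thesis
      by (blast intro: transition.sum_right braid_refl)
  next
    case (right Q1)
    with sum_right show ?thesis by (blast intro: transition.sum_right)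
  qed
next
  case (par_left \<Gamma> P c R Q)
  from par_left.prems obtain P1 Q1
    where PQ: "P' = Par P1 Q1" "braid \<Gamma> P P1" "braid \<Gamma> Q Q1" by (rule braid_ParE)
  obtain R' where "transition \<Gamma> P1 c R'" "braid \<Gamma> R R'"
    using par_left.IH[OF PQ(2)] par_left.hyps by (auto simp: bsize_def)
  then have "transition \<Gamma> P' c (Par R' Q1)" "braid \<Gamma> (Par R Q) (Par R' Q1)"
    using PQ par_left.hyps braid_scoped by (auto intro: transition.par_left braid.par)
  then show ?case using par_left.hyps by (auto simp: bsize_def)
next
  case (par_right \<Gamma> Q c S P)
  from par_right.prems obtain P1 Q1
    where PQ: "P' = Par P1 Q1" "braid \<Gamma> P P1" "braid \<Gamma> Q Q1" by (rule braid_ParE)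
  obtain S' where "transition \<Gamma> Q1 c S'" "braid \<Gamma> S S'"
    using par_right.IH[OF PQ(3)] par_right.hyps by (auto simp: bsize_def)
  then have "transition \<Gamma> P' c (Par P1 S')" "braid \<Gamma> (Par P S) (Par P1 S')"
    using PQ par_right.hyps braid_scoped by (auto intro: transition.par_right braid.par)
  then show ?case using par_right.hyps by (auto simp: bsize_def)
next
  case (par_left_bound \<Gamma> P b R Q)
  from par_left_bound.prems obtain P1 Q1
    where PQ: "P' = Par P1 Q1" "braid \<Gamma> P P1" "braid \<Gamma> Q Q1" by (rule braid_ParE)
  obtain R' where "transition \<Gamma> P1 b R'" "braid (Suc \<Gamma>) R R'"
    using par_left_bound.IH[OF PQ(2)] par_left_bound.hyps by (auto simp: bsize_def)
  then have "transition \<Gamma> P' b (Par R' (ren push Q1))"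
    "braid (Suc \<Gamma>) (Par R (ren push Q)) (Par R' (ren push Q1))"
    \<comment> \<open>The idle component is pushed under the new index, and its braid with
      it.\<close>
    using PQ par_left_bound.hyps braid_scoped
    by (auto intro: transition.par_left_bound braid.par braid_push)
  then show ?case using par_left_bound.hyps by (auto simp: bsize_def)
next
  case (par_right_bound \<Gamma> Q b S P)
  from par_right_bound.prems obtain P1 Q1
    where PQ: "P' = Par P1 Q1" "braid \<Gamma> P P1" "braid \<Gamma> Q Q1" by (rule braid_ParE)
  obtain S' where "transition \<Gamma> Q1 b S'" "braid (Suc \<Gamma>) S S'"
    using par_right_bound.IH[OF PQ(3)] par_right_bound.hyps by (auto simp: bsize_def)
  then have "transition \<Gamma> P' b (Par (ren push P1) S')"
    "braid (Suc \<Gamma>) (Par (ren push P) S) (Par (ren push P1) S')"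
    using PQ par_right_bound.hyps braid_scoped
    by (auto intro: transition.par_right_bound braid.par braid_push)
  then show ?case using par_right_bound.hyps by (auto simp: bsize_def)
next
  case (comm_left \<Gamma> P x R Q y S)
  from comm_left.prems obtain P1 Q1
    where PQ: "P' = Par P1 Q1" "braid \<Gamma> P P1" "braid \<Gamma> Q Q1" by (rule braid_ParE)
  obtain R' S' where "transition \<Gamma> P1 (AInp x) R'" "braid (Suc \<Gamma>) R R'"
    "transition \<Gamma> Q1 (AOut x y) S'" "braid \<Gamma> S S'"
    using comm_left.IH(1)[OF PQ(2)] comm_left.IH(2)[OF PQ(3)] by (auto simp: bsize_def)
  \<comment> \<open>This makes \<open>pop y\<close> a renaming from \<Gamma> + 1 to \<Gamma>, as
    \<open>braid_pop\<close> requires.\<close>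
  moreover have "y < \<Gamma>"
    using transition_scoped[OF comm_left.hyps(2)] by simp
  ultimately have "transition \<Gamma> P' ATau (Par (ren (pop y) R') S')"
    "braid \<Gamma> (Par (ren (pop y) R) S) (Par (ren (pop y) R') S')"
    using PQ by (auto intro: transition.comm_left braid.par braid_pop)
  then show ?case by (auto simp: bsize_def)
next
  case (comm_right \<Gamma> P x y R Q S)
  from comm_right.prems obtain P1 Q1
    where PQ: "P' = Par P1 Q1" "braid \<Gamma> P P1" "braid \<Gamma> Q Q1" by (rule braid_ParE)
  obtain R' S' where "transition \<Gamma> P1 (AOut x y) R'" "braid \<Gamma> R R'"
    "transition \<Gamma> Q1 (AInp x) S'" "braid (Suc \<Gamma>) S S'"
    using comm_right.IH(1)[OF PQ(2)] comm_right.IH(2)[OF PQ(3)] by (auto simp: bsize_def)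
  moreover have "y < \<Gamma>"
    using transition_scoped[OF comm_right.hyps(1)] by simp
  ultimately have "transition \<Gamma> P' ATau (Par R' (ren (pop y) S'))"
    "braid \<Gamma> (Par R (ren (pop y) S)) (Par R' (ren (pop y) S'))"
    using PQ by (auto intro: transition.comm_right braid.par braid_pop)
  then show ?case by (auto simp: bsize_def)
next
  case (extrude \<Gamma> P x R)
  from extrude.prems show ?case
  proof (cases rule: braid_NuE)
    case (swap R0)
    \<comment> \<open>The lemma is instantiated with \<open>ren swap R0\<close> as the body; the
      second \<open>swap\<close> cancels the first and leaves \<open>Nu (Nu R0)\<close>, which is
      \<open>P'\<close>.\<close>
    then show ?thesis
      using transition_Nu_Nu_swap[OF transition.extrude, of \<Gamma> "ren swap R0" x R] extrude.hyps by simp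
  next
    case (nu P1)
    \<comment> \<open>The non-bound premise in \<Gamma> + 1 and the bound conclusion in \<Gamma>
      have targets in the same context \<Gamma> + 1, so the braid from the induction hypothesis is
      used unchanged.\<close>
    then show ?thesis
      using extrude.IH by (fastforce simp: bsize_def intro: transition.extrude)
  qed
next
  case (close_left \<Gamma> P x R Q S)
  from close_left.prems obtain P1 Q1
    where PQ: "P' = Par P1 Q1" "braid \<Gamma> P P1" "braid \<Gamma> Q Q1" by (rule braid_ParE)
  obtain R' S' where "transition \<Gamma> P1 (AInp x) R'" "braid (Suc \<Gamma>) R R'"
    "transition \<Gamma> Q1 (ABOut x) S'" "braid (Suc \<Gamma>) S S'"
    using close_left.IH(1)[OF PQ(2)] close_left.IH(2)[OF PQ(3)] by (auto simp: bsize_def)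
  then have "transition \<Gamma> P' ATau (Nu (Par R' S'))" "braid \<Gamma> (Nu (Par R S)) (Nu (Par R' S'))"
    using PQ by (auto intro: transition.close_left intro!: braid.par braid.nu)
  then show ?case by (auto simp: bsize_def)
next
  case (close_right \<Gamma> P x R Q S)
  from close_right.prems obtain P1 Q1
    where PQ: "P' = Par P1 Q1" "braid \<Gamma> P P1" "braid \<Gamma> Q Q1" by (rule braid_ParE)
  obtain R' S' where "transition \<Gamma> P1 (ABOut x) R'" "braid (Suc \<Gamma>) R R'"
    "transition \<Gamma> Q1 (AInp x) S'" "braid (Suc \<Gamma>) S S'"
    using close_right.IH(1)[OF PQ(2)] close_right.IH(2)[OF PQ(3)] by (auto simp: bsize_def)
  then have "transition \<Gamma> P' ATau (Nu (Par R' S'))" "braid \<Gamma> (Nu (Par R S)) (Nu (Par R' S'))"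
    using PQ by (auto intro: transition.close_right intro!: braid.par braid.nu)
  then show ?case by (auto simp: bsize_def)
next
  case (nu \<Gamma> P c R)
  from nu.prems show ?case
  proof (cases rule: braid_NuE)
    case (swap R0)
    then show ?thesis
      using transition_Nu_Nu_swap[OF transition.nu, of \<Gamma> "ren swap R0" c R] nu.hyps by simp
  next
    case P1: (nu P1)
    then obtain R' where "transition (\<Gamma> + 1) P1 (aren push c) R'" "braid (\<Gamma> + 1) R R'"
      using nu.IH nu.hyps by (force simp: bsize_def)
    then have "transition \<Gamma> P' c (Nu R')" "braid \<Gamma> (Nu R) (Nu R')"
      using P1 nu.hyps by (auto intro: transition.nu braid.nu)
    then show ?thesis using nu.hyps by (auto simp: bsize_def)
  qed
next
  case (nu_bound \<Gamma> P b R)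
  from nu_bound.prems show ?case
  proof (cases rule: braid_NuE)
    case (swap R0)
    then show ?thesis
      using transition_Nu_Nu_swap[OF transition.nu_bound, of \<Gamma> "ren swap R0" b R] nu_bound.hyps by simp
  next
    case P1: (nu P1)
    then obtain R' where
      "transition (\<Gamma> + 1) P1 (aren push b) R'" "braid (Suc (Suc \<Gamma>)) R R'"
      using nu_bound.IH nu_bound.hyps by (force simp: bsize_def)
    then have "transition \<Gamma> P' b (Nu (ren swap R'))"
      "braid (Suc \<Gamma>) (Nu (ren swap R)) (Nu (ren swap R'))"
      using P1 nu_bound.hyps by (auto intro: transition.nu_bound intro!: braid.nu braid_ren_swap)
    then show ?thesis using nu_bound.hyps by (auto simp: bsize_def)
  qed
next
  case (bang \<Gamma> P a R)
  from bang.prems obtain P1 where P1: "P' = Bang P1" "braid \<Gamma> P P1" by (rule braid_BangE)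
  \<comment> \<open>Unfolding the replication on both sides gives a braid to which the induction
    hypothesis for the premise applies.\<close>
  then have "braid \<Gamma> (Par P (Bang P)) (Par P1 (Bang P1))" by (simp add: braid.par braid.bang)
  with P1(1) show ?case by (blast dest: bang.IH intro: transition.bang)
qed

theorem theorem4p5:
  fixes \<Gamma> :: nat and P P' R :: proc and a :: action
  assumes "Proc \<Gamma> P" and "Proc \<Gamma> P'"
    and "Action \<Gamma> a"
    and "Proc (\<Gamma> + bsize a) R"
    and "transition \<Gamma> P a R"
    and "braid \<Gamma> P P'"
  shows "\<exists>R'. Proc (\<Gamma> + bsize a) R' \<and> transition \<Gamma> P' a R' \<and> braid (\<Gamma> + bsize a) R R'"
  using braid_simulation[OF assms(5,6)] transition_scoped by blast

end
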